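(* Let $m\geq 0$ be an integer, let $\phi\in\mathbb{C}$ with $\Re(\phi)\neq 0$, and put $\sigma=\operatorname{sgn}(\Re(\phi))$. Then $$S_{2m+2}(\phi)=\frac{(2\phi)^{2m+2}}{(2m+1)!}\sum_{i=0}^{m} c_{2i+1}^{(m)}\,\mathcal{L}_{e^{-\sigma \phi}}(2i+1),$$ and, if $m\ge1$, $$S^{(\sinh,1)}_{2m+2}(\phi)=\frac{(2\sigma \phi)^{2m+1}\phi}{(2m)!}\sum_{i=0}^{m} d_{2i}^{(m)}\, \mathcal{L}_{e^{-\sigma\phi}}(2i).$$ Moreover, for every integer $\gamma$ with $0\le\gamma<m+1$, the series $S^{(\gamma)}_{2m+2}(\phi)$ and $S^{(\sinh,\gamma)}_{2m+2}(\phi)$ are finite linear combinations (with coefficients polynomial in $\phi$ on each of the two half-planes $\Re(\phi)>0$ and $\Re(\phi)<0$) of Lambert series $\mathcal{L}_{e^{-\sigma\phi}}(s)$ with $s$ non-negative integers.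
   Context: For integers $m\ge 0$ and $0\le \gamma<m+1$ and $\phi\in\mathbb{C}$ with $\Re(\phi)\neq0$, the hyperbolic series are $$S^{(\gamma)}_{2m+2}(\phi)=\sum_{n=1}^\infty \frac{\phi^{2m+2}\cosh^\gamma(n\phi)}{\sinh^{2m+2}(n\phi/2)},\quad S^{(\sinh,\gamma)}_{2m+2}(\phi)=\sum_{n=1}^\infty \frac{\phi^{2m+2}\sinh^\gamma(n\phi)}{\sinh^{2m+2}(n\phi/2)},\quad S_{2m+2}(\phi)=S^{(0)}_{2m+2}(\phi).$$ For $|q|<1$ the Lambert series is $\mathcal{L}_q(s)=\sum_{k=1}^\infty \frac{k^s q^k}{1-q^k}$. The real numbers $c_{2i+1}^{(m)}$ and $d_{2i}^{(m)}$ ($0\le i\le m$) are defined by the polynomial identities, for positive integers $k$, $$\binom{k+m}{k-m-1}=\frac{1}{(2m+1)!}\sum_{i=0}^{m} c_{2i+1}^{(m)} k^{2i+1},\qquad \binom{k+m-1}{k-m-1}+\binom{k+m}{k-m}=\frac{1}{(2m)!}\sum_{i=0}^{m} d_{2i}^{(m)} k^{2i},$$ where $\binom{a}{b}=0$ if $b<0$. *)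

theory Defs
  imports "HOL-Analysis.Analysis"
begin

section \<open>Hyperbolic series and Lambert series\<close>

text \<open>All series start at \<open>n = 1\<close>, hence the shift by \<^const>\<open>Suc\<close>. The parameter \<open>r\<close> is
  the subscript \<open>2 * m + 2\<close> of the series.\<close>

definition S_cosh :: "nat \<Rightarrow> nat \<Rightarrow> complex \<Rightarrow> complex" where
  "S_cosh \<gamma> r \<phi> = (\<Sum>n. \<phi> ^ r * cosh (of_nat (Suc n) * \<phi>) ^ \<gamma> / sinh (of_nat (Suc n) * \<phi> / 2) ^ r)"

definition S_sinh :: "nat \<Rightarrow> nat \<Rightarrow> complex \<Rightarrow> complex" where
  "S_sinh \<gamma> r \<phi> = (\<Sum>n. \<phi> ^ r * sinh (of_nat (Suc n) * \<phi>) ^ \<gamma> / sinh (of_nat (Suc n) * \<phi> / 2) ^ r)"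

abbreviation S_hyp :: "nat \<Rightarrow> complex \<Rightarrow> complex" where
  "S_hyp \<equiv> S_cosh 0"

definition lambert :: "complex \<Rightarrow> nat \<Rightarrow> complex" where
  "lambert q s = (\<Sum>k. of_nat (Suc k) ^ s * q ^ Suc k / (1 - q ^ Suc k))"

text \<open>The coefficients are uniform in \<open>\<phi>\<close> on each half-plane: they are polynomials
  \<open>p \<sigma> s\<close> evaluated at \<open>\<phi>\<close>, which depend on \<open>\<phi>\<close> otherwise only through \<open>\<sigma> = sgn (Re \<phi>)\<close>.\<close>

definition finite_lambert_combination :: "(complex \<Rightarrow> complex) \<Rightarrow> bool" where
  "finite_lambert_combination F \<longleftrightarrow>
     (\<exists>(A :: nat set) (p :: real \<Rightarrow> nat \<Rightarrow> complex poly). finite A \<and>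
        (\<forall>\<phi>. Re \<phi> \<noteq> 0 \<longrightarrow>
           F \<phi> = (\<Sum>s\<in>A. poly (p (sgn (Re \<phi>)) s) \<phi>
                          * lambert (exp (- of_real (sgn (Re \<phi>)) * \<phi>)) s)))"


section \<open>The coefficients \<open>c\<close> and \<open>d\<close>\<close>

definition int_binomial :: "int \<Rightarrow> int \<Rightarrow> real" where
  "int_binomial a b = (if b < 0 then 0 else of_int a gchoose nat b)"

text \<open>The second argument of \<open>c_coeff m\<close> and \<open>d_coeff m\<close> is the full subscript (\<open>2 * i + 1\<close>,
  respectively \<open>2 * i\<close>). Setting the coefficients to \<open>0\<close> at all other subscripts makes
  them unique as functions; see \<open>c_coeff_unique\<close> and \<open>d_coeff_unique\<close> below.\<close>

definition is_c_coeff :: "nat \<Rightarrow> (nat \<Rightarrow> real) \<Rightarrow> bool" where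
  "is_c_coeff m c \<longleftrightarrow>
     (\<forall>j. j \<notin> {2 * i + 1 | i. i \<le> m} \<longrightarrow> c j = 0) \<and>
     (\<forall>k::nat. k > 0 \<longrightarrow>
        int_binomial (int k + int m) (int k - int m - 1) =
        1 / fact (2 * m + 1) * (\<Sum>i\<le>m. c (2 * i + 1) * real k ^ (2 * i + 1)))"

definition is_d_coeff :: "nat \<Rightarrow> (nat \<Rightarrow> real) \<Rightarrow> bool" where
  "is_d_coeff m d \<longleftrightarrow>
     (\<forall>j. j \<notin> {2 * i | i. i \<le> m} \<longrightarrow> d j = 0) \<and>
     (\<forall>k::nat. k > 0 \<longrightarrow>
        int_binomial (int k + int m - 1) (int k - int m - 1) +
        int_binomial (int k + int m) (int k - int m) =
        1 / fact (2 * m) * (\<Sum>i\<le>m. d (2 * i) * real k ^ (2 * i)))"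

definition c_coeff :: "nat \<Rightarrow> nat \<Rightarrow> real" where
  "c_coeff m = (THE c. is_c_coeff m c)"

definition d_coeff :: "nat \<Rightarrow> nat \<Rightarrow> real" where
  "d_coeff m = (THE d. is_d_coeff m d)"


section \<open>Well-definedness\<close>

subsection \<open>Existence and uniqueness of the coefficients\<close>

lemma even_coeffs_unique:
  fixes a b :: "nat \<Rightarrow> real"
  assumes "\<And>k::nat. k > 0 \<Longrightarrow> (\<Sum>i\<le>m. a i * real k ^ (2 * i)) = (\<Sum>i\<le>m. b i * real k ^ (2 * i))"
    and "i \<le> m"
  shows "a i = b i"
proof -
  define p where "p = (\<Sum>i\<le>m. monom (a i - b i) i)"
  have ev: "poly p (real k ^ 2) = 0" if "k > 0" for k :: nat
    using assms(1)[OF that]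
    by (simp add: p_def poly_sum poly_monom left_diff_distrib sum_subtractf power_mult)
  have "infinite ((\<lambda>k. real k ^ 2) ` {0<..})"
    by (subst finite_image_iff) (auto simp: inj_on_def infinite_Ioi)
  moreover have "(\<lambda>k. real k ^ 2) ` {0<..} \<subseteq> {x. poly p x = 0}"
    using ev by auto
  ultimately have "p = 0"
    using poly_roots_finite finite_subset by blast
  then have "coeff p i = 0" by simp
  then show ?thesis
    using assms(2) by (simp add: p_def coeff_sum)
qed

lemma poly_sum_atMost:
  fixes r :: "real poly"
  assumes "degree r \<le> m"
  shows "poly r x = (\<Sum>i\<le>m. coeff r i * x ^ i)"
proof -
  have "(\<Sum>i\<le>m. coeff r i * x ^ i) = (\<Sum>i\<le>degree r. coeff r i * x ^ i)"
    by (rule sum.mono_neutral_right) (use assms in \<open>auto simp: coeff_eq_0\<close>)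
  then show ?thesis by (simp add: poly_altdef)
qed

lemma falling_prod:
  "(\<Prod>i<2 * m + 1. x + real m - real i) = x * (\<Prod>j=1..m. x\<^sup>2 - (real j)\<^sup>2)"
proof (induction m)
  case (Suc m)
  define P where "P n = (\<Prod>i<n. x + real m - real i)" for n
  have "(\<Prod>i<2 * Suc m + 1. x + real (Suc m) - real i)
      = (\<Prod>i<Suc (Suc (2 * m + 1)). x + real (Suc m) - real i)" by simp
  also have "\<dots> = (x + real (Suc m)) * (\<Prod>i<Suc (2 * m + 1). x + real (Suc m) - real (Suc i))"
    by (subst prod.lessThan_Suc_shift) simp
  also have "(\<Prod>i<Suc (2 * m + 1). x + real (Suc m) - real (Suc i)) = P (Suc (2 * m + 1))"
    unfolding P_def by (intro prod.cong) auto
  also have "\<dots> = P (2 * m + 1) * (x - real (Suc m))"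
    by (simp add: P_def)
  also have "P (2 * m + 1) = x * (\<Prod>j=1..m. x\<^sup>2 - (real j)\<^sup>2)"
    using Suc by (simp only: P_def)
  also have "(x + real (Suc m)) * (x * (\<Prod>j=1..m. x\<^sup>2 - (real j)\<^sup>2) * (x - real (Suc m)))
      = x * ((\<Prod>j=1..m. x\<^sup>2 - (real j)\<^sup>2) * (x\<^sup>2 - (real (Suc m))\<^sup>2))"
    by (simp only: power2_eq_square) (simp only: algebra_simps)
  finally show ?case by (simp only: prod.cl_ivl_Suc) simp
qed simp

lemma int_binomial_eq:
  assumes "n > 0" "a \<ge> 0" "b = a - int n"
  shows "int_binomial a b = (\<Prod>i<n. of_int a - real i) / fact n"
proof -
  define N where "N = nat a"
  have a: "a = int N" using assms by (simp add: N_def)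
  have gb: "(\<Prod>i<n. real N - real i) / fact n = real (N choose n)"
    by (simp add: binomial_gbinomial gbinomial_prod_rev atLeast0LessThan)
  have "int_binomial a b = real (N choose n)"
  proof (cases "n \<le> N")
    case True
    then have "nat b = N - n" "\<not> b < 0" using assms a by auto
    then show ?thesis
      using True a by (simp add: int_binomial_def binomial_gbinomial[symmetric] binomial_symmetric[of n N])
  next
    case False
    then show ?thesis using assms a by (simp add: int_binomial_def binomial_eq_0)
  qed
  then show ?thesis using gb a by simp
qed

definition root_poly :: "nat \<Rightarrow> real poly" where
  "root_poly m = (\<Prod>j=1..m. [:- ((real j)\<^sup>2), 1:])"

lemma degree_root_poly: "degree (root_poly m) \<le> m"
  unfolding root_poly_def
  by (rule order.trans[OF degree_prod_sum_le]) auto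

lemma poly_root_poly: "poly (root_poly m) (x\<^sup>2) = (\<Prod>j=1..m. x\<^sup>2 - (real j)\<^sup>2)"
  by (simp add: root_poly_def poly_prod)

lemma c_coeff_unique: "\<exists>!c. is_c_coeff m c"
proof (rule ex_ex1I)
  define c where "c j = (if j \<in> {2 * i + 1 | i. i \<le> m} then coeff (root_poly m) (j div 2) else 0)" for j
  have c: "c (2 * i + 1) = coeff (root_poly m) i" if "i \<le> m" for i
    using that by (auto simp: c_def)
  have "int_binomial (int k + int m) (int k - int m - 1) =
        1 / fact (2 * m + 1) * (\<Sum>i\<le>m. c (2 * i + 1) * real k ^ (2 * i + 1))" for k
  proof -
    have "(\<Sum>i\<le>m. c (2 * i + 1) * real k ^ (2 * i + 1))
        = real k * (\<Sum>i\<le>m. coeff (root_poly m) i * (real k ^ 2) ^ i)"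
      unfolding sum_distrib_left by (rule sum.cong) (simp_all only: c atMost_iff, simp add: power_mult)
    also have "\<dots> = (\<Prod>i<2 * m + 1. real k + real m - real i)"
      by (simp only: poly_sum_atMost[OF degree_root_poly, symmetric] poly_root_poly falling_prod)
    finally show ?thesis
      by (subst int_binomial_eq[where n = "2 * m + 1"]) auto
  qed
  then have "is_c_coeff m c"
    by (auto simp: is_c_coeff_def c_def)
  then show "\<exists>c. is_c_coeff m c" by blast
next
  fix a b assume ab: "is_c_coeff m a" "is_c_coeff m b"
  have eq: "(\<Sum>i\<le>m. a (2 * i + 1) * real k ^ (2 * i)) = (\<Sum>i\<le>m. b (2 * i + 1) * real k ^ (2 * i))"
    if k: "k > 0" for k :: nat
  proof -
    have shift: "(\<Sum>i\<le>m. f (2 * i + 1) * real k ^ (2 * i + 1)) = real k * (\<Sum>i\<le>m. f (2 * i + 1) * real k ^ (2 * i))"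
      for f :: "nat \<Rightarrow> real"
      by (simp add: sum_distrib_left mult_ac)
    have "1 / fact (2 * m + 1) * (\<Sum>i\<le>m. a (2 * i + 1) * real k ^ (2 * i + 1))
        = 1 / fact (2 * m + 1) * (\<Sum>i\<le>m. b (2 * i + 1) * real k ^ (2 * i + 1))"
      by (rule trans[OF sym]; rule ab(1)[unfolded is_c_coeff_def, THEN conjunct2, rule_format, OF k]
                              ab(2)[unfolded is_c_coeff_def, THEN conjunct2, rule_format, OF k])
    then show ?thesis
      unfolding shift mult_cancel_left using k by simp
  qed
  have "a (2 * i + 1) = b (2 * i + 1)" if "i \<le> m" for i
    using even_coeffs_unique[where m = m and a = "\<lambda>i. a (2 * i + 1)" and b = "\<lambda>i. b (2 * i + 1)" and i = i] eq that by blast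
  moreover have "a j = b j" if "j \<notin> {2 * i + 1 | i. i \<le> m}" for j
    using ab[unfolded is_c_coeff_def, THEN conjunct1, rule_format, OF that] by simp
  ultimately have "a j = b j" for j
    by (cases "j \<in> {2 * i + 1 | i. i \<le> m}") auto
  then show "a = b" ..
qed

lemma d_identity:
  "\<exists>r :: real poly. degree r \<le> m \<and> (\<forall>k::nat. k > 0 \<longrightarrow>
        int_binomial (int k + int m - 1) (int k - int m - 1) +
        int_binomial (int k + int m) (int k - int m) = 1 / fact (2 * m) * poly r ((real k)\<^sup>2))"
proof (cases m)
  case 0
  have "int_binomial (int k - 1) (int k - 1) + int_binomial (int k) (int k) = 2" if "k > 0" for k
  proof -
    have self: "int_binomial (int n) (int n) = 1" for n
      by (simp add: int_binomial_def flip: binomial_gbinomial)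
    have "int k - 1 = int (k - 1)" using that by simp
    then show ?thesis by (simp only: self)
  qed
  then show ?thesis
    using 0 by (intro exI[of _ "[:2:]"]) auto
next
  case (Suc l)
  define r where "r = smult 2 (pCons 0 (root_poly l))"
  have "degree r \<le> Suc (degree (root_poly l))"
    by (simp add: r_def degree_pCons_le)
  then have "degree r \<le> m"
    using degree_root_poly[of l] Suc by linarith
  moreover have "int_binomial (int k + int m - 1) (int k - int m - 1) +
        int_binomial (int k + int m) (int k - int m) = 1 / fact (2 * m) * poly r ((real k)\<^sup>2)"
    if "k > 0" for k
  proof -
    let ?P = "\<Prod>i<2 * l + 1. real k + real l - real i"
    have 1: "int_binomial (int k + int m - 1) (int k - int m - 1)
           = ?P * (real k - real m) / fact (2 * m)"
    proof -
      have "int_binomial (int k + int m - 1) (int k - int m - 1)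
          = (\<Prod>i<2 * m. of_int (int k + int m - 1) - real i) / fact (2 * m)"
        by (rule int_binomial_eq) (use Suc that in auto)
      also have "(\<Prod>i<2 * m. of_int (int k + int m - 1) - real i) = ?P * (real k - real m)"
        using Suc by (simp add: algebra_simps)
      finally show ?thesis .
    qed
    have 2: "int_binomial (int k + int m) (int k - int m)
           = (real k + real m) * ?P / fact (2 * m)"
    proof -
      have "int_binomial (int k + int m) (int k - int m)
          = (\<Prod>i<Suc (2 * l + 1). of_int (int k + int m) - real i) / fact (2 * m)"
        by (subst int_binomial_eq[where n = "2 * m"]) (use Suc that in auto)
      also have "(\<Prod>i<Suc (2 * l + 1). of_int (int k + int m) - real i) = (real k + real m) * ?P"
        unfolding prod.lessThan_Suc_shift using Suc by (simp add: algebra_simps)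
      finally show ?thesis .
    qed
    have "poly r ((real k)\<^sup>2) = 2 * real k * ?P"
      unfolding falling_prod unfolding poly_root_poly[symmetric]
      by (simp add: r_def) (simp add: power2_eq_square)
    moreover have "A * (real k - real m) / F + (real k + real m) * A / F = 1 / F * (2 * real k * A)"
      for A F :: real
      by (simp add: algebra_simps flip: add_divide_distrib)
    ultimately show ?thesis
      unfolding 1 2 by (simp only:)
  qed
  ultimately show ?thesis by blast
qed

lemma d_coeff_unique: "\<exists>!d. is_d_coeff m d"
proof (rule ex_ex1I)
  obtain r :: "real poly" where r: "degree r \<le> m" "\<And>k::nat. k > 0 \<Longrightarrow>
        int_binomial (int k + int m - 1) (int k - int m - 1) +
        int_binomial (int k + int m) (int k - int m) = 1 / fact (2 * m) * poly r ((real k)\<^sup>2)"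
    using d_identity[of m] by auto
  define d where "d j = (if j \<in> {2 * i | i. i \<le> m} then coeff r (j div 2) else 0)" for j
  have d: "d (2 * i) = coeff r i" if "i \<le> m" for i
    using that by (auto simp: d_def)
  have "(\<Sum>i\<le>m. d (2 * i) * real k ^ (2 * i)) = poly r ((real k)\<^sup>2)" for k
    unfolding poly_sum_atMost[OF r(1)] by (rule sum.cong) (simp_all add: d power_mult)
  then have "is_d_coeff m d"
    using r(2) by (auto simp: is_d_coeff_def d_def)
  then show "\<exists>d. is_d_coeff m d" by blast
next
  fix a b assume ab: "is_d_coeff m a" "is_d_coeff m b"
  have eq: "(\<Sum>i\<le>m. a (2 * i) * real k ^ (2 * i)) = (\<Sum>i\<le>m. b (2 * i) * real k ^ (2 * i))"
    if k: "k > 0" for k :: nat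
  proof -
    have "1 / fact (2 * m) * (\<Sum>i\<le>m. a (2 * i) * real k ^ (2 * i))
        = 1 / fact (2 * m) * (\<Sum>i\<le>m. b (2 * i) * real k ^ (2 * i))"
      by (rule trans[OF sym]; rule ab(1)[unfolded is_d_coeff_def, THEN conjunct2, rule_format, OF k]
                              ab(2)[unfolded is_d_coeff_def, THEN conjunct2, rule_format, OF k])
    then show ?thesis
      unfolding mult_cancel_left by simp
  qed
  have "a (2 * i) = b (2 * i)" if "i \<le> m" for i
    using even_coeffs_unique[where m = m and a = "\<lambda>i. a (2 * i)" and b = "\<lambda>i. b (2 * i)" and i = i] eq that by blast
  moreover have "a j = b j" if "j \<notin> {2 * i | i. i \<le> m}" for j
    using ab[unfolded is_d_coeff_def, THEN conjunct1, rule_format, OF that] by simp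
  ultimately have "a j = b j" for j
    by (cases "j \<in> {2 * i | i. i \<le> m}") auto
  then show "a = b" ..
qed

lemma is_c_coeff_c_coeff: "is_c_coeff m (c_coeff m)"
  unfolding c_coeff_def by (rule theI'[OF c_coeff_unique])

lemma is_d_coeff_d_coeff: "is_d_coeff m (d_coeff m)"
  unfolding d_coeff_def by (rule theI'[OF d_coeff_unique])


subsection \<open>Convergence of the series\<close>

lemma summable_lambert:
  fixes q :: complex
  assumes "norm q < 1"
  shows "summable (\<lambda>k. of_nat (Suc k) ^ s * q ^ Suc k / (1 - q ^ Suc k))"
proof -
  define x where "x = norm q"
  have x: "0 \<le> x" "x < 1" using assms by (auto simp: x_def)
  have "summable (\<lambda>k. norm (of_nat k ^ s * x ^ k))"
  proof (cases "x = 0")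
    case True
    then have "\<And>k. k \<notin> {0} \<Longrightarrow> norm (of_nat k ^ s * x ^ k) = 0" by simp
    then show ?thesis by (intro summable_finite[of "{0}"]) auto
  next
    case False
    then have "0 < x" using x by simp
    have "(\<lambda>k. (1 + 1 / real (Suc k)) ^ s * x) \<longlonglongrightarrow> (1 + 0) ^ s * x"
      by (intro tendsto_intros LIMSEQ_Suc lim_1_over_n)
    moreover obtain c where c: "x < c" "c < 1" using x dense by blast
    ultimately have "eventually (\<lambda>k. (1 + 1 / real (Suc k)) ^ s * x < c) sequentially"
      by (intro order_tendstoD) auto
    then obtain N where N: "\<And>k. k \<ge> N \<Longrightarrow> (1 + 1 / real (Suc k)) ^ s * x < c"
      by (auto simp: eventually_at_top_linorder)
    have "summable (\<lambda>k. norm (of_nat (Suc k) ^ s * x ^ Suc k))"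
    proof (rule summable_ratio_test[OF c(2)])
      fix k assume "N \<le> k"
      from N[OF this] have "(1 + 1 / real (Suc k)) ^ s * x * (real (Suc k) ^ s * x ^ Suc k) \<le> c * (real (Suc k) ^ s * x ^ Suc k)"
        by (intro mult_right_mono) (use x in auto)
      moreover have "(1 + 1 / real (Suc k)) ^ s * real (Suc k) ^ s = real (Suc (Suc k)) ^ s"
        by (simp add: field_simps flip: power_mult_distrib)
      then have "(1 + 1 / real (Suc k)) ^ s * x * (real (Suc k) ^ s * x ^ Suc k) = real (Suc (Suc k)) ^ s * x ^ Suc (Suc k)"
        by (metis mult.assoc mult.commute power_Suc)
      ultimately show "norm (norm (of_nat (Suc (Suc k)) ^ s * x ^ Suc (Suc k)))
          \<le> c * norm (norm (of_nat (Suc k) ^ s * x ^ Suc k))"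
        using x by (simp add: abs_mult del: of_nat_Suc power_Suc)
    qed
    then show ?thesis by (subst (asm) summable_Suc_iff)
  qed
  then have "summable (\<lambda>k. norm (of_nat (Suc k) ^ s * x ^ Suc k) * (1 / (1 - x)))"
    by (intro summable_mult2) (subst summable_Suc_iff)
  then show ?thesis
  proof (rule summable_comparison_test'[where N = 0])
    fix k
    have "x ^ Suc k \<le> x" using x by (simp add: mult_left_le power_le_one)
    moreover have "norm (1 - q ^ Suc k) \<ge> 1 - x ^ Suc k"
      using norm_triangle_ineq2[of 1 "q ^ Suc k"] by (simp add: x_def norm_power norm_mult)
    ultimately have "norm (1 - q ^ Suc k) \<ge> 1 - x" by linarith
    then have "real (Suc k) ^ s * x ^ Suc k / norm (1 - q ^ Suc k) \<le> real (Suc k) ^ s * x ^ Suc k / (1 - x)"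
      by (intro divide_left_mono mult_pos_pos) (use x in auto)
    then show "norm (of_nat (Suc k) ^ s * q ^ Suc k / (1 - q ^ Suc k))
        \<le> norm (of_nat (Suc k) ^ s * x ^ Suc k) * (1 / (1 - x))"
      using x by (simp add: norm_mult norm_divide norm_power x_def abs_mult del: of_nat_Suc power_Suc)
  qed
qed

lemma norm_cosh_le: "norm (cosh z) \<le> exp \<bar>Re z\<bar>" for z :: complex
proof -
  have "norm (cosh z) \<le> (norm (exp z) + norm (exp (- z))) / 2"
    using norm_triangle_ineq[of "exp z" "exp (- z)"] by (simp add: cosh_def scaleR_conv_of_real norm_mult)
  also have "\<dots> \<le> exp \<bar>Re z\<bar>"
  proof -
    have "exp (Re z) \<le> exp \<bar>Re z\<bar>" "exp (- Re z) \<le> exp \<bar>Re z\<bar>" by auto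
    then show ?thesis unfolding norm_exp_eq_Re by (simp del: exp_le_cancel_iff)
  qed
  finally show ?thesis .
qed

lemma norm_sinh_le: "norm (sinh z) \<le> exp \<bar>Re z\<bar>" for z :: complex
proof -
  have "norm (sinh z) \<le> (norm (exp z) + norm (exp (- z))) / 2"
    using norm_triangle_ineq4[of "exp z" "exp (- z)"] by (simp add: sinh_def scaleR_conv_of_real norm_mult)
  also have "\<dots> \<le> exp \<bar>Re z\<bar>"
  proof -
    have "exp (Re z) \<le> exp \<bar>Re z\<bar>" "exp (- Re z) \<le> exp \<bar>Re z\<bar>" by auto
    then show ?thesis unfolding norm_exp_eq_Re by (simp del: exp_le_cancel_iff)
  qed
  finally show ?thesis .
qed

lemma norm_sinh_ge: "norm (sinh z) \<ge> (exp \<bar>Re z\<bar> - exp (- \<bar>Re z\<bar>)) / 2" for z :: complex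
proof -
  have "norm (sinh z) \<ge> \<bar>norm (exp z) - norm (exp (- z))\<bar> / 2"
    using norm_triangle_ineq3[of "exp z" "exp (- z)"] by (simp add: sinh_def scaleR_conv_of_real norm_mult)
  then show ?thesis by (auto simp: abs_if split: if_splits)
qed

lemma summable_hyp_aux:
  fixes h :: "complex \<Rightarrow> complex"
  assumes h: "\<And>z. norm (h z) \<le> exp \<bar>Re z\<bar>" and "\<gamma> < m + 1" "Re \<phi> \<noteq> 0"
  shows "summable (\<lambda>n. \<phi> ^ (2 * m + 2) * h (of_nat (Suc n) * \<phi>) ^ \<gamma>
                        / sinh (of_nat (Suc n) * \<phi> / 2) ^ (2 * m + 2))"
proof -
  define x where "x = \<bar>Re \<phi>\<bar>"
  define r where "r = 2 * m + 2"
  define C where "C = norm (\<phi> ^ r) / ((1 - exp (- x)) / 2) ^ r"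
  have x: "x > 0" using assms by (simp add: x_def)
  have "summable (\<lambda>n. C * exp (- x) ^ Suc n)"
    by (intro summable_mult summable_ignore_initial_segment[of _ 1, simplified] summable_geometric)
       (use x in auto)
  then have "summable (\<lambda>n. \<phi> ^ r * h (of_nat (Suc n) * \<phi>) ^ \<gamma> / sinh (of_nat (Suc n) * \<phi> / 2) ^ r)"
  proof (rule summable_comparison_test'[where N = 0])
    fix n
    define t where "t = real (Suc n) * x"
    have t: "t \<ge> x" using x by (simp add: t_def)
    have hb: "norm (h (of_nat (Suc n) * \<phi>)) \<le> exp t"
      using h[of "of_nat (Suc n) * \<phi>"] by (simp add: t_def x_def abs_mult del: of_nat_Suc)
    have "exp (t / 2) * ((1 - exp (- x)) / 2) \<le> exp (t / 2) * ((1 - exp (- t)) / 2)"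
      using t by (intro mult_left_mono) auto
    also have "\<dots> = (exp (t / 2) - exp (- (t / 2))) / 2"
      by (simp add: algebra_simps flip: exp_add)
    also have "\<dots> \<le> norm (sinh (of_nat (Suc n) * \<phi> / 2))"
      using norm_sinh_ge[of "of_nat (Suc n) * \<phi> / 2"] by (simp add: t_def x_def abs_mult del: of_nat_Suc)
    finally have sb: "norm (sinh (of_nat (Suc n) * \<phi> / 2)) \<ge> exp (t / 2) * ((1 - exp (- x)) / 2)" .
    have pos: "exp (t / 2) * ((1 - exp (- x)) / 2) > 0" using x by simp
    have "norm (\<phi> ^ r * h (of_nat (Suc n) * \<phi>) ^ \<gamma> / sinh (of_nat (Suc n) * \<phi> / 2) ^ r)
        = norm (\<phi> ^ r) * norm (h (of_nat (Suc n) * \<phi>)) ^ \<gamma> / norm (sinh (of_nat (Suc n) * \<phi> / 2)) ^ r"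
      by (simp add: norm_mult norm_divide norm_power del: of_nat_Suc)
    also have "\<dots> \<le> norm (\<phi> ^ r) * exp t ^ \<gamma> / (exp (t / 2) * ((1 - exp (- x)) / 2)) ^ r"
      by (intro frac_le mult_left_mono power_mono hb sb zero_less_power pos mult_nonneg_nonneg)
         (use pos x in auto)
    also have "\<dots> = C * (exp t ^ \<gamma> / exp (t / 2) ^ r)"
      by (simp only: C_def power_mult_distrib) (simp add: field_simps)
    also have "exp (t / 2) ^ r = exp t ^ Suc m"
    proof -
      have "exp t = exp (t / 2) ^ 2"
        by (simp flip: exp_of_nat_mult)
      then have "exp t ^ Suc m = exp (t / 2) ^ (2 * Suc m)"
        by (simp only: power_mult)
      then show ?thesis by (simp add: r_def)
    qed
    also have "exp t ^ \<gamma> / exp t ^ Suc m = exp (- (real (Suc m - \<gamma>) * t))"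
    proof -
      have "exp t ^ Suc m = exp t ^ \<gamma> * exp t ^ (Suc m - \<gamma>)"
        using assms(2) by (simp only: flip: power_add) simp
      moreover have "exp (- (real (Suc m - \<gamma>) * t)) = inverse (exp t ^ (Suc m - \<gamma>))"
        by (simp only: exp_minus exp_of_nat_mult)
      ultimately show ?thesis by (simp only:) (simp add: field_simps)
    qed
    also have "C * exp (- (real (Suc m - \<gamma>) * t)) \<le> C * exp (- t)"
    proof -
      have "1 * t \<le> real (Suc m - \<gamma>) * t"
        using assms(2) x t by (intro mult_right_mono) auto
      then show ?thesis using x by (intro mult_left_mono) (auto simp: C_def)
    qed
    also have "exp (- t) = exp (- x) ^ Suc n"
      unfolding t_def by (simp only: flip: exp_of_nat_mult) simp
    finally show "norm (\<phi> ^ r * h (of_nat (Suc n) * \<phi>) ^ \<gamma> / sinh (of_nat (Suc n) * \<phi> / 2) ^ r)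
        \<le> C * exp (- x) ^ Suc n" .
  qed
  then show ?thesis by (simp only: r_def)
qed

lemmas summable_S_cosh = summable_hyp_aux[of cosh, OF norm_cosh_le]

lemmas summable_S_sinh = summable_hyp_aux[of sinh, OF norm_sinh_le]

end

theory Submission
  imports Defs
begin

text \<open>Put \<open>\<sigma> = sgn (Re \<phi>)\<close> and \<open>q = exp (- \<sigma> * \<phi>)\<close>, so that \<open>norm q < 1\<close>. In terms of \<open>x = q ^ n\<close> the
  \<open>n\<close>-th term of each hyperbolic series is a rational function, namely a constant times
  \<open>x ^ (m + 1 - \<gamma>) * (1 + x\<^sup>2) ^ \<gamma> / (1 - x) ^ (2 * m + 2)\<close>, with \<open>1 - x\<^sup>2\<close> in place of \<open>1 + x\<^sup>2\<close> for
  \<open>sinh\<close> (\<open>hyperbolic_term_rational\<close>). The constant contains \<open>\<sigma> ^ \<gamma>\<close> in the \<open>sinh\<close> case because \<open>sinh\<close>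
  is odd; the denominator is an even power of \<open>sinh\<close>, so it does not see \<open>\<sigma>\<close>.

  For \<open>\<gamma> \<le> m\<close> the numerator vanishes at \<open>0\<close> and has degree \<open>m + 1 + \<gamma> \<le> 2 * m + 1\<close>, which is less
  than the degree of the denominator. The coefficient of \<open>x ^ k\<close> in the Taylor expansion is therefore
  the value at \<open>k\<close> of one polynomial for all \<open>k \<ge> 1\<close>, without exceptional initial terms, and the
  constant term is \<open>0\<close> (\<open>proper_fraction_coefficients_polynomial\<close>). For
  \<open>x ^ (m + 1) / (1 - x) ^ (2 * m + 2)\<close> and \<open>x ^ m * (1 + x) / (1 - x) ^ (2 * m + 1)\<close> the binomial
  series gives exactly the binomial coefficients that define \<open>c_coeff\<close> and \<open>d_coeff\<close>.

  Finally, summing \<open>k ^ s * x ^ k\<close> over \<open>k\<close> and over \<open>x = q ^ n\<close> gives \<open>lambert q s\<close>: the double series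
  converges absolutely, and for fixed \<open>k\<close> the sum over \<open>n\<close> is geometric
  (\<open>lambert_transform_sums\<close>, \<open>sums_lambert_combination\<close>).\<close>

section \<open>Power series of proper rational functions with pole at one\<close>

text \<open>The binomial series multiplied by \<open>x ^ j\<close>. The coefficient formula stays correct for
  exponents below \<open>j\<close>, since the upper index then drops below \<open>N\<close> and the binomial vanishes. By
  \<open>1 \<le> j\<close> this includes the exponent \<open>0\<close>, so the series may start at \<open>1\<close>.\<close>
lemma sums_binomial_shifted:
  fixes x :: complex
  assumes "norm x < 1" "1 \<le> j" "j \<le> N"
  shows "(\<lambda>k. of_nat ((Suc k + N - j) choose N) * x ^ Suc k) sums (x ^ j / (1 - x) ^ Suc N)"
proof -
  have "(\<lambda>n. of_nat ((n + N) choose N) * x ^ n) sums (1 / (1 - x) ^ Suc N)"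
  proof -
    have "((- of_nat (Suc N)) gchoose n) * (- x) ^ n = of_nat ((n + N) choose N) * x ^ n" for n
    proof -
      have "((- of_nat (Suc N) :: complex) gchoose n) = (- 1) ^ n * of_nat ((n + N) choose n)"
        unfolding gbinomial_minus by (simp add: binomial_gbinomial add_ac)
      moreover have "(n + N) choose n = (n + N) choose N"
        using binomial_symmetric[of n "n + N"] by simp
      ultimately show ?thesis
        by (simp add: uminus_power_if)
    qed
    moreover have "(1 - x) powr (- of_nat (Suc N)) = 1 / (1 - x) ^ Suc N"
    proof -
      have "1 - x \<noteq> 0" using assms by auto
      then have "(1 - x) powr of_nat (Suc N) = (1 - x) ^ Suc N" by (intro powr_nat') simp
      then show ?thesis by (simp only: powr_minus inverse_eq_divide)
    qed
    ultimately show ?thesis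
      using gen_binomial_complex[of "- x" "- of_nat (Suc N)"] assms by simp
  qed
  then have "(\<lambda>n. x ^ j * (of_nat ((n + N) choose N) * x ^ n)) sums (x ^ j * (1 / (1 - x) ^ Suc N))"
    by (rule sums_mult)
  then have "(\<lambda>n. of_nat ((n + j + N - j) choose N) * x ^ (n + j)) sums (x ^ j / (1 - x) ^ Suc N)"
    by (simp add: power_add mult_ac)
  \<comment> \<open>The first \<open>j\<close> coefficients are zero, so the index may be shifted back.\<close>
  then have "(\<lambda>n. of_nat ((n + N - j) choose N) * x ^ n) sums (x ^ j / (1 - x) ^ Suc N)"
    by (subst (asm) sums_zero_iff_shift) (use assms in \<open>auto simp: binomial_eq_0\<close>)
  then show ?thesis
    using assms by (subst sums_Suc_iff) (simp add: binomial_eq_0)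
qed

lemma binomial_polynomial:
  assumes "j \<le> N"
  shows "\<exists>P :: complex poly. \<forall>k. poly P (of_nat k) = of_nat ((k + N - j) choose N)"
proof (intro exI allI)
  fix k
  have "poly (\<Prod>i<N. [:of_nat (N - j) - of_nat i, 1:]) (of_nat k :: complex)
      = (\<Prod>i<N. of_nat (k + N - j) - of_nat i)"
    using assms by (simp add: poly_prod algebra_simps flip: of_nat_add)
  then show "poly (smult (1 / fact N) (\<Prod>i<N. [:of_nat (N - j) - of_nat i, 1:])) (of_nat k :: complex)
      = of_nat ((k + N - j) choose N)"
    by (simp add: binomial_gbinomial gbinomial_prod_rev atLeast0LessThan)
qed

text \<open>A numerator of degree at most \<open>N\<close> without constant term is a combination of the monomials
  \<open>x ^ j\<close> with \<open>1 \<le> j \<le> N\<close>, and each of these contributes a binomial coefficient polynomial in \<open>k\<close>.\<close>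
lemma proper_fraction_coefficients_polynomial:
  fixes R :: "complex poly"
  assumes "degree R \<le> N" "coeff R 0 = 0"
  shows "\<exists>P :: complex poly. \<forall>x. norm x < 1 \<longrightarrow>
           (\<lambda>k. poly P (of_nat (Suc k)) * x ^ Suc k) sums (poly R x / (1 - x) ^ Suc N)"
proof -
  have "\<forall>j\<in>{1..N}. \<exists>P :: complex poly. \<forall>k. poly P (of_nat k) = of_nat ((k + N - j) choose N)"
    using binomial_polynomial by simp
  then obtain B :: "nat \<Rightarrow> complex poly" where
    B: "\<And>j k. j \<in> {1..N} \<Longrightarrow> poly (B j) (of_nat k) = of_nat ((k + N - j) choose N)"
    by metis
  define P where "P = (\<Sum>j=1..N. smult (coeff R j) (B j))"
  have "(\<lambda>k. poly P (of_nat (Suc k)) * x ^ Suc k) sums (poly R x / (1 - x) ^ Suc N)" if x: "norm x < 1" for x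
  proof -
    have "(\<lambda>k. \<Sum>j=1..N. coeff R j * (of_nat ((Suc k + N - j) choose N) * x ^ Suc k))
        sums (\<Sum>j=1..N. coeff R j * (x ^ j / (1 - x) ^ Suc N))"
      by (intro sums_sum sums_mult sums_binomial_shifted x) auto
    moreover have "(\<Sum>j=1..N. coeff R j * (of_nat ((Suc k + N - j) choose N) * x ^ Suc k))
        = poly P (of_nat (Suc k)) * x ^ Suc k" for k
      unfolding P_def poly_sum poly_smult sum_distrib_right
      by (rule sum.cong) (simp_all only: B mult.assoc)
    moreover have "(\<Sum>j=1..N. coeff R j * x ^ j) = poly R x"
    proof -
      have "poly R x = (\<Sum>j\<le>N. coeff R j * x ^ j)"
        unfolding poly_altdef
        by (rule sum.mono_neutral_left) (use assms in \<open>auto simp: coeff_eq_0\<close>)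
      also have "\<dots> = (\<Sum>j=1..N. coeff R j * x ^ j)"
        by (rule sum.mono_neutral_right) (use assms in \<open>auto simp: not_less_eq_eq\<close>)
      finally show ?thesis ..
    qed
    ultimately show ?thesis
      by (simp only: times_divide_eq_right sum_divide_distrib [symmetric])
  qed
  then show ?thesis by blast
qed

section \<open>Double series and Lambert series\<close>

text \<open>Lambert's rearrangement for arbitrary coefficients \<open>a\<close>: Fubini for the double series
  \<open>a k * q ^ (n * k)\<close>. The hypothesis \<open>abs\<close> is the iterated sum of the absolute values, with the
  geometric inner sum already evaluated, so it is absolute convergence of the double series.\<close>
lemma lambert_transform_sums:
  fixes q :: complex and a F :: "nat \<Rightarrow> complex"
  assumes q: "norm q < 1"
    and abs: "summable (\<lambda>k. norm (a k) * (norm q ^ Suc k / (1 - norm q ^ Suc k)))"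
    and F: "\<And>n. (\<lambda>k. a k * (q ^ Suc n) ^ Suc k) sums F n"
  shows "F sums (\<Sum>k. a k * (q ^ Suc k / (1 - q ^ Suc k)))"
proof -
  define f where "f = (\<lambda>(k, n). a k * (q ^ Suc n) ^ Suc k)"
  have geometric: "(\<lambda>n. c * (x ^ Suc n) ^ Suc k) sums (c * (x ^ Suc k / (1 - x ^ Suc k)))"
    if "norm x < 1" for c x :: "'a :: {real_normed_field, banach}" and k
  proof -
    have "norm (x ^ Suc k) < 1"
      unfolding norm_power using that by (simp add: power_less_one_iff del: power_Suc)
    then have "(\<lambda>n. c * x ^ Suc k * (x ^ Suc k) ^ n) sums (c * x ^ Suc k * (1 / (1 - x ^ Suc k)))"
      by (intro sums_mult geometric_sums)
    moreover have "c * x ^ Suc k * (x ^ Suc k) ^ n = c * (x ^ Suc n) ^ Suc k" for n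
    proof -
      have "(x ^ Suc n) ^ Suc k = (x ^ Suc k) ^ Suc n"
        by (simp only: power_mult [symmetric] mult.commute)
      then show ?thesis by (simp only: power_Suc [of "x ^ Suc k"] mult.assoc)
    qed
    ultimately show ?thesis by (simp only: mult.assoc times_divide_eq_right mult_1_right)
  qed
  have norm_row: "(\<lambda>n. norm (f (k, n))) sums (norm (a k) * (norm q ^ Suc k / (1 - norm q ^ Suc k)))" for k
    using geometric[of "norm q" "norm (a k)" k] q by (simp add: f_def norm_mult norm_power del: power_Suc)
  have "(\<lambda>p. norm (f p)) summable_on UNIV \<times> UNIV"
  proof (rule summable_on_SigmaI)
    show "((\<lambda>n. norm (f (k, n))) has_sum norm (a k) * (norm q ^ Suc k / (1 - norm q ^ Suc k))) UNIV" for k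
      by (rule sums_nonneg_imp_has_sum[OF norm_row]) simp
    have "norm (a k) * (norm q ^ Suc k / (1 - norm q ^ Suc k)) \<ge> 0" for k
      using q by (intro mult_nonneg_nonneg divide_nonneg_nonneg) (auto intro: power_le_one simp del: power_Suc)
    then show "(\<lambda>k. norm (a k) * (norm q ^ Suc k / (1 - norm q ^ Suc k))) summable_on UNIV"
      using abs by (subst summable_on_UNIV_nonneg_real_iff) auto
  qed auto
  then have "f summable_on UNIV \<times> UNIV" by (rule abs_summable_summable)
  then obtain S where S: "(f has_sum S) (UNIV \<times> UNIV)" by (auto simp: summable_on_def)
  then have S': "((\<lambda>(n, k). f (k, n)) has_sum S) (UNIV \<times> UNIV)" by (subst (asm) has_sum_swap)
  have "((\<lambda>n. f (k, n)) has_sum (a k * (q ^ Suc k / (1 - q ^ Suc k)))) UNIV" for k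
    using sums_summable[OF norm_row[of k]] geometric[OF q, of "a k" k]
    by (intro norm_summable_imp_has_sum) (simp_all only: f_def split)
  then have "((\<lambda>k. a k * (q ^ Suc k / (1 - q ^ Suc k))) has_sum S) UNIV"
    by (intro has_sum_SigmaD[OF S]) auto
  then have "S = (\<Sum>k. a k * (q ^ Suc k / (1 - q ^ Suc k)))"
    using has_sum_imp_sums sums_unique by blast
  moreover have "((\<lambda>k. f (k, n)) has_sum F n) UNIV" for n
  proof -
    have "(\<lambda>k. f (k, n)) summable_on UNIV"
      using summable_on_SigmaD1[of "\<lambda>n k. f (k, n)" UNIV "\<lambda>_. UNIV" n] S' by (auto simp: summable_on_def)
    then obtain T where T: "((\<lambda>k. f (k, n)) has_sum T) UNIV" by (auto simp: summable_on_def)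
    have "(\<lambda>k. f (k, n)) sums F n" using F[of n] by (simp only: f_def split)
    then have "T = F n" using has_sum_imp_sums[OF T] sums_unique2 by blast
    then show ?thesis using T by simp
  qed
  then have "(F has_sum S) UNIV"
    by (intro has_sum_SigmaD[OF S']) auto
  ultimately show ?thesis using has_sum_imp_sums by blast
qed

text \<open>Applied to polynomial coefficients \<open>k \<mapsto> \<Sum>i\<in>I. \<alpha> i * k ^ e i\<close>, the transform produces Lambert
  series. The exponents are indexed by a separate function \<open>e\<close>, so that only odd or only even powers
  can be used.\<close>
lemma sums_lambert_combination:
  fixes q :: complex and \<alpha> :: "'i \<Rightarrow> complex" and e :: "'i \<Rightarrow> nat"
  assumes q: "norm q < 1"
    and F: "\<And>x. norm x < 1 \<Longrightarrow> (\<lambda>k. (\<Sum>i\<in>I. \<alpha> i * of_nat (Suc k) ^ e i) * x ^ Suc k) sums F x"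
  shows "(\<lambda>n. F (q ^ Suc n)) sums (\<Sum>i\<in>I. \<alpha> i * lambert q (e i))"
proof -
  define a where "a k = (\<Sum>i\<in>I. \<alpha> i * of_nat (Suc k) ^ e i)" for k
  have "(\<lambda>n. F (q ^ Suc n)) sums (\<Sum>k. a k * (q ^ Suc k / (1 - q ^ Suc k)))"
  proof (rule lambert_transform_sums[OF q])
    have "norm (q ^ Suc n) < 1" for n
      unfolding norm_power using q by (simp add: power_less_one_iff del: power_Suc)
    then show "(\<lambda>k. a k * (q ^ Suc n) ^ Suc k) sums F (q ^ Suc n)" for n
      unfolding a_def by (rule F)
    have pos: "norm q ^ Suc k / (1 - norm q ^ Suc k) \<ge> 0" for k
      using q by (intro divide_nonneg_nonneg) (auto intro: power_le_one simp del: power_Suc)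
    \<comment> \<open>The majorant is the Lambert series at the real point \<open>norm q\<close>.\<close>
    have "summable (\<lambda>k. real (Suc k) ^ s * (norm q ^ Suc k / (1 - norm q ^ Suc k)))" for s
    proof -
      have "norm (complex_of_real (norm q)) < 1" using q by simp
      then have "summable (\<lambda>k. complex_of_real (real (Suc k) ^ s * (norm q ^ Suc k / (1 - norm q ^ Suc k))))"
        using summable_lambert[of "of_real (norm q)" s]
        by (simp only: of_real_mult of_real_power of_real_of_nat_eq of_real_divide of_real_diff of_real_1 times_divide_eq_right)
      then show ?thesis by (simp only: summable_complex_of_real)
    qed
    then have "summable (\<lambda>k. \<Sum>i\<in>I. norm (\<alpha> i) * (real (Suc k) ^ e i * (norm q ^ Suc k / (1 - norm q ^ Suc k))))"
      by (intro summable_sum summable_mult)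
    then show "summable (\<lambda>k. norm (a k) * (norm q ^ Suc k / (1 - norm q ^ Suc k)))"
    proof (rule summable_comparison_test'[where N = 0])
      fix k
      have "norm (a k) \<le> (\<Sum>i\<in>I. norm (\<alpha> i) * real (Suc k) ^ e i)"
        unfolding a_def by (rule order.trans[OF norm_sum]) (simp only: norm_mult norm_power norm_of_nat order_refl)
      then have "norm (a k) * (norm q ^ Suc k / (1 - norm q ^ Suc k))
          \<le> (\<Sum>i\<in>I. norm (\<alpha> i) * real (Suc k) ^ e i) * (norm q ^ Suc k / (1 - norm q ^ Suc k))"
        using pos by (intro mult_right_mono)
      then show "norm (norm (a k) * (norm q ^ Suc k / (1 - norm q ^ Suc k)))
          \<le> (\<Sum>i\<in>I. norm (\<alpha> i) * (real (Suc k) ^ e i * (norm q ^ Suc k / (1 - norm q ^ Suc k))))"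
        unfolding sum_distrib_right real_norm_def abs_mult abs_of_nonneg[OF pos] abs_norm_cancel
        by (simp only: mult.assoc)
    qed
  qed
  also have "(\<Sum>k. a k * (q ^ Suc k / (1 - q ^ Suc k)))
      = (\<Sum>k. \<Sum>i\<in>I. \<alpha> i * (of_nat (Suc k) ^ e i * q ^ Suc k / (1 - q ^ Suc k)))"
    unfolding a_def sum_distrib_right by (simp only: mult.assoc times_divide_eq_right)
  also have "\<dots> = (\<Sum>i\<in>I. \<alpha> i * lambert q (e i))"
    unfolding lambert_def
    by (subst suminf_sum) (intro summable_mult summable_lambert q, simp only: suminf_mult[OF summable_lambert[OF q]])
  finally show ?thesis .
qed

section \<open>Hyperbolic terms as rational functions\<close>

lemma cosh_sinh_rational:
  fixes z :: complex
  defines "x \<equiv> exp (- z)"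
  shows "cosh z = (1 + x\<^sup>2) / (2 * x)"
    and "sinh z = (1 - x\<^sup>2) / (2 * x)"
    and "(sinh (z / 2))\<^sup>2 = (1 - x)\<^sup>2 / (4 * x)"
proof -
  have inv: "exp z = 1 / x" by (simp add: x_def exp_minus field_simps)
  have nz: "x \<noteq> 0" by (simp add: x_def)
  show "cosh z = (1 + x\<^sup>2) / (2 * x)"
    unfolding cosh_def inv x_def[symmetric] using nz
    by (simp add: scaleR_conv_of_real field_simps power2_eq_square)
  show "sinh z = (1 - x\<^sup>2) / (2 * x)"
    unfolding sinh_def inv x_def[symmetric] using nz
    by (simp add: scaleR_conv_of_real field_simps power2_eq_square)
  define y where "y = exp (- (z / 2))"
  have x: "x = y\<^sup>2" and "y \<noteq> 0"
    by (simp_all add: x_def y_def flip: exp_of_nat_mult)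
  have inv': "exp (z / 2) = 1 / y" by (simp add: y_def exp_minus field_simps)
  show "(sinh (z / 2))\<^sup>2 = (1 - x)\<^sup>2 / (4 * x)"
    unfolding sinh_def x y_def[symmetric] inv' using \<open>y \<noteq> 0\<close>
    by (simp add: scaleR_conv_of_real field_simps power2_eq_square)
qed

text \<open>The argument is replaced by \<open>z = \<sigma> * (n + 1) * \<phi>\<close>, for which \<open>x = exp (- z)\<close>. The factor
  \<open>1 / x ^ \<gamma>\<close> from the numerator and \<open>x ^ (m + 1)\<close> from the denominator combine to \<open>x ^ (m + 1 - \<gamma>)\<close>.\<close>
lemma hyperbolic_term_rational:
  fixes \<phi> \<sigma> :: complex and n m \<gamma> :: nat
  assumes \<sigma>: "\<sigma> = 1 \<or> \<sigma> = - 1" and \<gamma>: "\<gamma> \<le> m"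
  defines "x \<equiv> exp (- \<sigma> * \<phi>) ^ Suc n"
  shows "\<phi> ^ (2 * m + 2) * cosh (of_nat (Suc n) * \<phi>) ^ \<gamma> / sinh (of_nat (Suc n) * \<phi> / 2) ^ (2 * m + 2)
       = \<phi> ^ (2 * m + 2) * 4 ^ (m + 1) / 2 ^ \<gamma> * (x ^ (m + 1 - \<gamma>) * (1 + x\<^sup>2) ^ \<gamma> / (1 - x) ^ (2 * m + 2))"
    and "\<phi> ^ (2 * m + 2) * sinh (of_nat (Suc n) * \<phi>) ^ \<gamma> / sinh (of_nat (Suc n) * \<phi> / 2) ^ (2 * m + 2)
       = \<sigma> ^ \<gamma> * \<phi> ^ (2 * m + 2) * 4 ^ (m + 1) / 2 ^ \<gamma> * (x ^ (m + 1 - \<gamma>) * (1 - x\<^sup>2) ^ \<gamma> / (1 - x) ^ (2 * m + 2))"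
proof -
  define w where "w = of_nat (Suc n) * \<phi>"
  define z where "z = \<sigma> * w"
  have x: "x = exp (- z)"
    unfolding x_def z_def w_def exp_of_nat_mult [symmetric] by (simp add: algebra_simps)
  then have nz: "x \<noteq> 0" by simp
  have "cosh w = cosh z" "sinh w = \<sigma> * sinh z" "(sinh (w / 2))\<^sup>2 = (sinh (z / 2))\<^sup>2"
    using \<sigma> by (auto simp: z_def)
  then have ch: "cosh w = (1 + x\<^sup>2) / (2 * x)" and sh: "sinh w = \<sigma> * ((1 - x\<^sup>2) / (2 * x))"
    and half: "(sinh (w / 2))\<^sup>2 = (1 - x)\<^sup>2 / (4 * x)"
    using cosh_sinh_rational[of z] by (simp_all only: x)
  have denom: "sinh (w / 2) ^ (2 * m + 2) = (1 - x) ^ (2 * m + 2) / (4 ^ (m + 1) * x ^ (m + 1))"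
  proof -
    have "sinh (w / 2) ^ (2 * m + 2) = ((sinh (w / 2))\<^sup>2) ^ (m + 1)"
      by (simp only: power_mult [symmetric]) simp
    also have "\<dots> = ((1 - x) ^ 2) ^ (m + 1) / (4 ^ (m + 1) * x ^ (m + 1))"
      by (simp only: half power_divide power_mult_distrib)
    also have "((1 - x) ^ 2) ^ (m + 1) = (1 - x) ^ (2 * m + 2)"
      by (simp only: power_mult [symmetric]) simp
    finally show ?thesis .
  qed
  have "x ^ (m + 1) = x ^ (m + 1 - \<gamma>) * x ^ \<gamma>"
    using \<gamma> by (simp only: power_add [symmetric]) simp
  then have quotient: "(t / (2 * x)) ^ \<gamma> / sinh (w / 2) ^ (2 * m + 2)
      = 4 ^ (m + 1) / 2 ^ \<gamma> * (x ^ (m + 1 - \<gamma>) * t ^ \<gamma> / (1 - x) ^ (2 * m + 2))" for t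
    unfolding denom using nz by (simp add: power_divide power_mult_distrib del: power_Suc)
  show "\<phi> ^ (2 * m + 2) * cosh (of_nat (Suc n) * \<phi>) ^ \<gamma> / sinh (of_nat (Suc n) * \<phi> / 2) ^ (2 * m + 2)
       = \<phi> ^ (2 * m + 2) * 4 ^ (m + 1) / 2 ^ \<gamma> * (x ^ (m + 1 - \<gamma>) * (1 + x\<^sup>2) ^ \<gamma> / (1 - x) ^ (2 * m + 2))"
    using quotient[of "1 + x\<^sup>2"] unfolding w_def[symmetric] ch
    by (simp only: times_divide_eq_right [symmetric] mult.assoc)
  show "\<phi> ^ (2 * m + 2) * sinh (of_nat (Suc n) * \<phi>) ^ \<gamma> / sinh (of_nat (Suc n) * \<phi> / 2) ^ (2 * m + 2)
       = \<sigma> ^ \<gamma> * \<phi> ^ (2 * m + 2) * 4 ^ (m + 1) / 2 ^ \<gamma> * (x ^ (m + 1 - \<gamma>) * (1 - x\<^sup>2) ^ \<gamma> / (1 - x) ^ (2 * m + 2))"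
    using quotient[of "1 - x\<^sup>2"] unfolding w_def[symmetric] sh power_mult_distrib[of \<sigma>]
    by (simp only: times_divide_eq_right [symmetric] mult.assoc mult.left_commute)
qed

section \<open>Hyperbolic series as combinations of Lambert series\<close>

text \<open>An expansion of the rational function at \<open>0\<close> with coefficients polynomial in \<open>k\<close> determines the
  hyperbolic series: it is summed along the powers of \<open>q\<close>, which lie in the unit disc by the choice of
  the sign.\<close>
lemma S_cosh_lambert_combination:
  fixes \<alpha> :: "'i \<Rightarrow> complex" and e :: "'i \<Rightarrow> nat"
  assumes \<phi>: "Re \<phi> \<noteq> 0" and \<gamma>: "\<gamma> \<le> m"
    and expansion: "\<And>x. norm x < 1 \<Longrightarrow> (\<lambda>k. (\<Sum>i\<in>I. \<alpha> i * of_nat (Suc k) ^ e i) * x ^ Suc k)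
           sums (x ^ (m + 1 - \<gamma>) * (1 + x\<^sup>2) ^ \<gamma> / (1 - x) ^ (2 * m + 2))"
  shows "S_cosh \<gamma> (2 * m + 2) \<phi> = \<phi> ^ (2 * m + 2) * 4 ^ (m + 1) / 2 ^ \<gamma> *
           (\<Sum>i\<in>I. \<alpha> i * lambert (exp (- of_real (sgn (Re \<phi>)) * \<phi>)) (e i))"
proof -
  have \<sigma>: "complex_of_real (sgn (Re \<phi>)) = 1 \<or> complex_of_real (sgn (Re \<phi>)) = - 1"
    using \<phi> by (auto simp: sgn_real_def)
  have "norm (exp (- of_real (sgn (Re \<phi>)) * \<phi>)) < 1"
    using \<phi> by (simp add: norm_exp_eq_Re sgn_real_def)
  note sums_lambert_combination[OF this expansion]
  note sums_mult[OF this, of "\<phi> ^ (2 * m + 2) * 4 ^ (m + 1) / 2 ^ \<gamma>"]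
  then show ?thesis
    unfolding S_cosh_def hyperbolic_term_rational(1)[OF \<sigma> \<gamma>] by (rule sums_unique [symmetric])
qed

lemma S_sinh_lambert_combination:
  fixes \<alpha> :: "'i \<Rightarrow> complex" and e :: "'i \<Rightarrow> nat"
  assumes \<phi>: "Re \<phi> \<noteq> 0" and \<gamma>: "\<gamma> \<le> m"
    and expansion: "\<And>x. norm x < 1 \<Longrightarrow> (\<lambda>k. (\<Sum>i\<in>I. \<alpha> i * of_nat (Suc k) ^ e i) * x ^ Suc k)
           sums (x ^ (m + 1 - \<gamma>) * (1 - x\<^sup>2) ^ \<gamma> / (1 - x) ^ (2 * m + 2))"
  shows "S_sinh \<gamma> (2 * m + 2) \<phi> = of_real (sgn (Re \<phi>)) ^ \<gamma> * \<phi> ^ (2 * m + 2) * 4 ^ (m + 1) / 2 ^ \<gamma> *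
           (\<Sum>i\<in>I. \<alpha> i * lambert (exp (- of_real (sgn (Re \<phi>)) * \<phi>)) (e i))"
proof -
  have \<sigma>: "complex_of_real (sgn (Re \<phi>)) = 1 \<or> complex_of_real (sgn (Re \<phi>)) = - 1"
    using \<phi> by (auto simp: sgn_real_def)
  have "norm (exp (- of_real (sgn (Re \<phi>)) * \<phi>)) < 1"
    using \<phi> by (simp add: norm_exp_eq_Re sgn_real_def)
  note sums_lambert_combination[OF this expansion]
  note sums_mult[OF this, of "of_real (sgn (Re \<phi>)) ^ \<gamma> * \<phi> ^ (2 * m + 2) * 4 ^ (m + 1) / 2 ^ \<gamma>"]
  then show ?thesis
    unfolding S_sinh_def hyperbolic_term_rational(2)[OF \<sigma> \<gamma>] by (rule sums_unique [symmetric])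
qed

section \<open>Expansions of the rational functions at zero\<close>

text \<open>Both sides vanish when \<open>N < n\<close>, which covers the small \<open>k\<close> in the identities that define
  \<open>c_coeff\<close> and \<open>d_coeff\<close>.\<close>
lemma int_binomial_eq_choose:
  assumes "n > 0" "a = int N" "b = a - int n"
  shows "int_binomial a b = real (N choose n)"
  using int_binomial_eq[of n a b] assms
  by (simp add: binomial_gbinomial gbinomial_prod_rev atLeast0LessThan)

text \<open>With \<open>j = m + 1\<close> and \<open>N = 2 * m + 1\<close> the shifted binomial series has the coefficients
  \<open>(k + m) choose (2 * m + 1)\<close>, which \<open>c_coeff\<close> expands in powers of \<open>k\<close>.\<close>
lemma c_coeff_expansion:
  fixes x :: complex
  assumes "norm x < 1"
  shows "(\<lambda>k. (\<Sum>i\<le>m. of_real (c_coeff m (2 * i + 1)) / fact (2 * m + 1) * of_nat (Suc k) ^ (2 * i + 1)) * x ^ Suc k)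
           sums (x ^ (m + 1) / (1 - x) ^ (2 * m + 2))"
proof -
  have "(\<Sum>i\<le>m. of_real (c_coeff m (2 * i + 1)) / fact (2 * m + 1) * of_nat (Suc k) ^ (2 * i + 1))
      = complex_of_nat ((Suc k + (2 * m + 1) - (m + 1)) choose (2 * m + 1))" for k
  proof -
    have "1 / fact (2 * m + 1) * (\<Sum>i\<le>m. c_coeff m (2 * i + 1) * real (Suc k) ^ (2 * i + 1))
        = int_binomial (int (Suc k) + int m) (int (Suc k) - int m - 1)"
      using is_c_coeff_c_coeff[of m, unfolded is_c_coeff_def, THEN conjunct2, rule_format, of "Suc k"] by (simp only: zero_less_Suc)
    also have "\<dots> = real ((Suc k + m) choose (2 * m + 1))"
      by (rule int_binomial_eq_choose) simp_all
    finally have "complex_of_real (1 / fact (2 * m + 1) * (\<Sum>i\<le>m. c_coeff m (2 * i + 1) * real (Suc k) ^ (2 * i + 1)))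
        = of_nat ((Suc k + m) choose (2 * m + 1))"
      by (simp only: of_real_of_nat_eq)
    then show ?thesis
      by (simp add: sum_distrib_left add.commute del: of_nat_Suc fact_Suc power_Suc)
  qed
  then show ?thesis
    using sums_binomial_shifted[OF assms, of "m + 1" "2 * m + 1"] by simp
qed

text \<open>The two binomials in the identity for \<open>d_coeff\<close> come from the two monomials of the
  numerator \<open>x ^ m + x ^ (m + 1)\<close>. For \<open>m = 0\<close> the function has the constant term \<open>1\<close>, which a series
  starting at \<open>k = 1\<close> misses.\<close>
lemma d_coeff_expansion:
  fixes x :: complex
  assumes "norm x < 1" "m \<ge> 1"
  shows "(\<lambda>k. (\<Sum>i\<le>m. of_real (d_coeff m (2 * i)) / fact (2 * m) * of_nat (Suc k) ^ (2 * i)) * x ^ Suc k)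
           sums (x ^ m * (1 + x) / (1 - x) ^ (2 * m + 1))"
proof -
  have "(\<Sum>i\<le>m. of_real (d_coeff m (2 * i)) / fact (2 * m) * of_nat (Suc k) ^ (2 * i))
      = complex_of_nat ((Suc k + 2 * m - m) choose (2 * m))
        + complex_of_nat ((Suc k + 2 * m - (m + 1)) choose (2 * m))" for k
  proof -
    have "1 / fact (2 * m) * (\<Sum>i\<le>m. d_coeff m (2 * i) * real (Suc k) ^ (2 * i))
        = int_binomial (int (Suc k) + int m - 1) (int (Suc k) - int m - 1)
          + int_binomial (int (Suc k) + int m) (int (Suc k) - int m)"
      using is_d_coeff_d_coeff[of m, unfolded is_d_coeff_def, THEN conjunct2, rule_format, of "Suc k"] by (simp only: zero_less_Suc)
    also have "\<dots> = real ((k + m) choose (2 * m)) + real ((Suc k + m) choose (2 * m))"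
      by (intro arg_cong2[where f = "(+)"] int_binomial_eq_choose) (use assms in simp_all)
    finally have "complex_of_real (1 / fact (2 * m) * (\<Sum>i\<le>m. d_coeff m (2 * i) * real (Suc k) ^ (2 * i)))
        = of_nat ((k + m) choose (2 * m)) + of_nat ((Suc k + m) choose (2 * m))"
      by (simp only: of_real_of_nat_eq of_real_add)
    then show ?thesis
      by (simp add: sum_distrib_left add.commute del: of_nat_Suc fact_Suc power_Suc)
  qed
  then show ?thesis
    using sums_add[OF sums_binomial_shifted[OF assms(1), of m "2 * m"] sums_binomial_shifted[OF assms(1), of "m + 1" "2 * m"]] assms(2)
    by (simp add: algebra_simps add_divide_distrib)
qed

text \<open>The parameter \<open>\<delta>\<close> is \<open>1\<close> for \<open>cosh\<close> and \<open>- 1\<close> for \<open>sinh\<close>. The condition \<open>\<gamma> \<le> m\<close> enters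
  twice: it makes the numerator vanish at \<open>0\<close>, and it keeps its degree \<open>m + 1 + \<gamma>\<close> below that of the
  denominator.\<close>
lemma numerator_expansion:
  fixes \<delta> :: complex
  assumes "\<gamma> \<le> m"
  shows "\<exists>P :: complex poly. \<forall>x. norm x < 1 \<longrightarrow>
           (\<lambda>k. (\<Sum>i\<le>degree P. coeff P i * of_nat (Suc k) ^ i) * x ^ Suc k)
             sums (x ^ (m + 1 - \<gamma>) * (1 + \<delta> * x\<^sup>2) ^ \<gamma> / (1 - x) ^ (2 * m + 2))"
proof -
  define R where "R = monom 1 (m + 1 - \<gamma>) * [:1, 0, \<delta>:] ^ \<gamma>"
  have "degree [:1, 0, \<delta>:] \<le> 2" by simp
  then have "degree ([:1, 0, \<delta>:] ^ \<gamma>) \<le> 2 * \<gamma>"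
    using degree_power_le[of "[:1, 0, \<delta>:]" \<gamma>] by (meson mult_le_mono1 order.trans)
  then have "degree R \<le> 2 * m + 1"
    unfolding R_def using assms degree_mult_le[of "monom 1 (m + 1 - \<gamma>)" "[:1, 0, \<delta>:] ^ \<gamma>"]
    by (simp add: degree_monom_eq)
  moreover have "coeff R 0 = 0"
    using assms by (simp add: R_def coeff_mult coeff_monom)
  moreover have "poly R x = x ^ (m + 1 - \<gamma>) * (1 + \<delta> * x\<^sup>2) ^ \<gamma>" for x
    by (simp add: R_def poly_monom power2_eq_square mult_ac)
  ultimately show ?thesis
    using proper_fraction_coefficients_polynomial[of R "2 * m + 1"] by (simp add: poly_altdef)
qed

theorem proposition2p6:
  fixes m :: nat
  shows "(\<forall>\<phi> :: complex. Re \<phi> \<noteq> 0 \<longrightarrow>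
            S_hyp (2 * m + 2) \<phi> =
              (2 * \<phi>) ^ (2 * m + 2) / fact (2 * m + 1) *
              (\<Sum>i\<le>m. of_real (c_coeff m (2 * i + 1)) *
                       lambert (exp (- of_real (sgn (Re \<phi>)) * \<phi>)) (2 * i + 1)))
       \<and> (\<forall>\<phi> :: complex. Re \<phi> \<noteq> 0 \<longrightarrow> m \<ge> 1 \<longrightarrow>
            S_sinh 1 (2 * m + 2) \<phi> =
              (2 * of_real (sgn (Re \<phi>)) * \<phi>) ^ (2 * m + 1) * \<phi> / fact (2 * m) *
              (\<Sum>i\<le>m. of_real (d_coeff m (2 * i)) *
                       lambert (exp (- of_real (sgn (Re \<phi>)) * \<phi>)) (2 * i)))
       \<and> (\<forall>\<gamma>::nat. \<gamma> < m + 1 \<longrightarrow>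
            finite_lambert_combination (S_cosh \<gamma> (2 * m + 2)) \<and>
            finite_lambert_combination (S_sinh \<gamma> (2 * m + 2)))"
proof (intro conjI allI impI)
  fix \<phi> :: complex
  assume \<phi>: "Re \<phi> \<noteq> 0"
  let ?L = "lambert (exp (- of_real (sgn (Re \<phi>)) * \<phi>))"
  have "S_hyp (2 * m + 2) \<phi> = \<phi> ^ (2 * m + 2) * 4 ^ (m + 1) / 2 ^ 0 *
      (\<Sum>i\<le>m. of_real (c_coeff m (2 * i + 1)) / fact (2 * m + 1) * ?L (2 * i + 1))"
    using c_coeff_expansion[of _ m] by (intro S_cosh_lambert_combination[OF \<phi>]) simp_all
  also have "(\<Sum>i\<le>m. of_real (c_coeff m (2 * i + 1)) / fact (2 * m + 1) * ?L (2 * i + 1))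
      = (\<Sum>i\<le>m. of_real (c_coeff m (2 * i + 1)) * ?L (2 * i + 1)) / fact (2 * m + 1)"
    by (simp only: sum_divide_distrib times_divide_eq_left)
  also have "\<phi> ^ (2 * m + 2) * 4 ^ (m + 1) / 2 ^ 0 = (2 * \<phi>) ^ (2 * m + 2)"
  proof -
    have "(4 :: complex) ^ (m + 1) = 2 ^ (2 * (m + 1))" by (simp only: power_mult) simp
    then show ?thesis by (simp add: power_mult_distrib mult_ac)
  qed
  finally show "S_hyp (2 * m + 2) \<phi> = (2 * \<phi>) ^ (2 * m + 2) / fact (2 * m + 1) *
      (\<Sum>i\<le>m. of_real (c_coeff m (2 * i + 1)) * ?L (2 * i + 1))"
    by (simp only: times_divide_eq_left times_divide_eq_right)
next
  fix \<phi> :: complex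
  assume \<phi>: "Re \<phi> \<noteq> 0" and m: "m \<ge> 1"
  let ?\<sigma> = "complex_of_real (sgn (Re \<phi>))"
  let ?L = "lambert (exp (- ?\<sigma> * \<phi>))"
  \<comment> \<open>For exponent one, a factor \<open>1 - x\<close> of \<open>1 - x\<^sup>2\<close> cancels, which leaves the function expanded by \<open>d_coeff\<close>.\<close>
  have cancel: "x ^ m * (1 + x) / (1 - x) ^ (2 * m + 1) = x ^ (m + 1 - 1) * (1 - x\<^sup>2) ^ 1 / (1 - x) ^ (2 * m + 2)"
    if "norm x < 1" for x :: complex
  proof -
    have "x \<noteq> 1" using that by auto
    moreover have "1 - x\<^sup>2 = (1 + x) * (1 - x)" by (simp add: power2_eq_square algebra_simps)
    ultimately show ?thesis by simp
  qed
  have "S_sinh 1 (2 * m + 2) \<phi> = ?\<sigma> ^ 1 * \<phi> ^ (2 * m + 2) * 4 ^ (m + 1) / 2 ^ 1 *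
      (\<Sum>i\<le>m. of_real (d_coeff m (2 * i)) / fact (2 * m) * ?L (2 * i))"
    using d_coeff_expansion[OF _ m] m
    by (intro S_sinh_lambert_combination[OF \<phi>]) (simp_all only: cancel)
  also have "(\<Sum>i\<le>m. of_real (d_coeff m (2 * i)) / fact (2 * m) * ?L (2 * i))
      = (\<Sum>i\<le>m. of_real (d_coeff m (2 * i)) * ?L (2 * i)) / fact (2 * m)"
    by (simp only: sum_divide_distrib times_divide_eq_left)
  also have "?\<sigma> ^ 1 * \<phi> ^ (2 * m + 2) * 4 ^ (m + 1) / 2 ^ 1 = (2 * ?\<sigma> * \<phi>) ^ (2 * m + 1) * \<phi>"
  proof -
    have "(4 :: complex) ^ (m + 1) = 2 * 2 ^ (2 * m + 1)" by (simp add: power_mult)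
    moreover have "?\<sigma> ^ (2 * m + 1) = ?\<sigma>" using \<phi> by (auto simp: sgn_real_def)
    moreover have "?\<sigma> ^ 1 * \<phi> ^ (2 * m + 2) * (2 * 2 ^ (2 * m + 1)) / 2 ^ 1
        = 2 ^ (2 * m + 1) * ?\<sigma> * \<phi> ^ (2 * m + 1) * \<phi>" by simp
    ultimately show ?thesis by (simp only: power_mult_distrib)
  qed
  finally show "S_sinh 1 (2 * m + 2) \<phi> = (2 * ?\<sigma> * \<phi>) ^ (2 * m + 1) * \<phi> / fact (2 * m) *
      (\<Sum>i\<le>m. of_real (d_coeff m (2 * i)) * ?L (2 * i))"
    by (simp only: times_divide_eq_left times_divide_eq_right)
next
  fix \<gamma> :: nat
  assume "\<gamma> < m + 1"
  then have \<gamma>: "\<gamma> \<le> m" by simp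
  obtain P :: "complex poly" where P: "\<And>x. norm x < 1 \<Longrightarrow>
      (\<lambda>k. (\<Sum>i\<le>degree P. coeff P i * of_nat (Suc k) ^ i) * x ^ Suc k)
        sums (x ^ (m + 1 - \<gamma>) * (1 + x\<^sup>2) ^ \<gamma> / (1 - x) ^ (2 * m + 2))"
    using numerator_expansion[OF \<gamma>, of 1] by auto
  have "S_cosh \<gamma> (2 * m + 2) \<phi> =
      (\<Sum>s\<le>degree P. poly (monom (4 ^ (m + 1) / 2 ^ \<gamma> * coeff P s) (2 * m + 2)) \<phi>
        * lambert (exp (- of_real (sgn (Re \<phi>)) * \<phi>)) s)" if "Re \<phi> \<noteq> 0" for \<phi>
  proof -
    have "S_cosh \<gamma> (2 * m + 2) \<phi> = \<phi> ^ (2 * m + 2) * 4 ^ (m + 1) / 2 ^ \<gamma> *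
        (\<Sum>s\<le>degree P. coeff P s * lambert (exp (- of_real (sgn (Re \<phi>)) * \<phi>)) s)"
      by (rule S_cosh_lambert_combination[OF that \<gamma> P])
    then show ?thesis
      unfolding sum_distrib_left poly_monom by (simp add: mult_ac)
  qed
  then show "finite_lambert_combination (S_cosh \<gamma> (2 * m + 2))"
    unfolding finite_lambert_combination_def
    by (intro exI[of _ "{..degree P}"]
          exI[of _ "\<lambda>_ s. monom (4 ^ (m + 1) / 2 ^ \<gamma> * coeff P s) (2 * m + 2)"]) simp
next
  fix \<gamma> :: nat
  assume "\<gamma> < m + 1"
  then have \<gamma>: "\<gamma> \<le> m" by simp
  obtain P :: "complex poly" where P: "\<And>x. norm x < 1 \<Longrightarrow>
      (\<lambda>k. (\<Sum>i\<le>degree P. coeff P i * of_nat (Suc k) ^ i) * x ^ Suc k)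
        sums (x ^ (m + 1 - \<gamma>) * (1 - x\<^sup>2) ^ \<gamma> / (1 - x) ^ (2 * m + 2))"
    using numerator_expansion[OF \<gamma>, of "- 1"] by auto
  have "S_sinh \<gamma> (2 * m + 2) \<phi> =
      (\<Sum>s\<le>degree P. poly (monom (of_real (sgn (Re \<phi>)) ^ \<gamma> * 4 ^ (m + 1) / 2 ^ \<gamma> * coeff P s) (2 * m + 2)) \<phi>
        * lambert (exp (- of_real (sgn (Re \<phi>)) * \<phi>)) s)" if "Re \<phi> \<noteq> 0" for \<phi>
  proof -
    have "S_sinh \<gamma> (2 * m + 2) \<phi> = of_real (sgn (Re \<phi>)) ^ \<gamma> * \<phi> ^ (2 * m + 2) * 4 ^ (m + 1) / 2 ^ \<gamma> *
        (\<Sum>s\<le>degree P. coeff P s * lambert (exp (- of_real (sgn (Re \<phi>)) * \<phi>)) s)"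
      by (rule S_sinh_lambert_combination[OF that \<gamma> P])
    then show ?thesis
      unfolding sum_distrib_left poly_monom by (simp add: mult_ac)
  qed
  then show "finite_lambert_combination (S_sinh \<gamma> (2 * m + 2))"
    unfolding finite_lambert_combination_def
    by (intro exI[of _ "{..degree P}"]
          exI[of _ "\<lambda>\<sigma> s. monom (of_real \<sigma> ^ \<gamma> * 4 ^ (m + 1) / 2 ^ \<gamma> * coeff P s) (2 * m + 2)"]) simp
qed

end
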